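(* For each prime $n>2$ with $n\equiv 2\pmod 3$, there is a permutation of $\mathbb{Z}_n$ whose graph contains exactly $(n-1)(n-2)/6$ collinear triples but no collinear quadruples.
   Context: $\mathbb{Z}_n$ denotes the integers modulo $n$. A permutation of $\mathbb{Z}_n$ is a bijection $\sigma:\mathbb{Z}_n\to\mathbb{Z}_n$, and its graph is $\{(x,\sigma(x)) : x\in\mathbb{Z}_n\}\subset\mathbb{Z}_n\times\mathbb{Z}_n$. For $n$ prime, a set of points $X\subset\mathbb{Z}_n\times\mathbb{Z}_n$ is called collinear if there are $a,b,c\in\mathbb{Z}_n$ with $(a,b)\neq(0,0)$ such that every $(i,j)\in X$ lies on the line $\{(x,y)\in\mathbb{Z}_n\times\mathbb{Z}_n : ax+by=c\}$. A collinear triple (respectively, collinear quadruple) is a collinear set of exactly three (respectively, four) distinct points; triples and quadruples are unordered. *)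

theory Defs
  imports "HOL-Number_Theory.Number_Theory"
begin

text \<open>The integers modulo \<open>n\<close>, represented by the library's ring of least nonnegative residues,
  with carrier \<open>{0..n - 1}\<close>.\<close>
abbreviation Zmod :: "nat \<Rightarrow> int ring"
  where "Zmod n \<equiv> residue_ring (int n)"

abbreviation Zset :: "nat \<Rightarrow> int set"
  where "Zset n \<equiv> carrier (Zmod n)"

definition perm_Z :: "nat \<Rightarrow> (int \<Rightarrow> int) \<Rightarrow> bool"
  where "perm_Z n \<sigma> \<longleftrightarrow> bij_betw \<sigma> (Zset n) (Zset n)"

definition graph_Z :: "nat \<Rightarrow> (int \<Rightarrow> int) \<Rightarrow> (int \<times> int) set"
  where "graph_Z n \<sigma> = {(x, \<sigma> x) | x. x \<in> Zset n}"

definition line_Z :: "nat \<Rightarrow> int \<Rightarrow> int \<Rightarrow> int \<Rightarrow> (int \<times> int) set"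
  where "line_Z n a b c =
    {(x, y). x \<in> Zset n \<and> y \<in> Zset n \<and> a \<otimes>\<^bsub>Zmod n\<^esub> x \<oplus>\<^bsub>Zmod n\<^esub> b \<otimes>\<^bsub>Zmod n\<^esub> y = c}"

definition collinear_Z :: "nat \<Rightarrow> (int \<times> int) set \<Rightarrow> bool"
  where "collinear_Z n X \<longleftrightarrow>
    (\<exists>a \<in> Zset n. \<exists>b \<in> Zset n. \<exists>c \<in> Zset n.
      (a, b) \<noteq> (\<zero>\<^bsub>Zmod n\<^esub>, \<zero>\<^bsub>Zmod n\<^esub>) \<and> X \<subseteq> line_Z n a b c)"

definition collinear_triples :: "nat \<Rightarrow> (int \<times> int) set \<Rightarrow> (int \<times> int) set set"
  where "collinear_triples n S = {X. X \<subseteq> S \<and> card X = 3 \<and> collinear_Z n X}"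

definition collinear_quadruples :: "nat \<Rightarrow> (int \<times> int) set \<Rightarrow> (int \<times> int) set set"
  where "collinear_quadruples n S = {X. X \<subseteq> S \<and> card X = 4 \<and> collinear_Z n X}"

end

theory Submission
  imports Defs
begin

text \<open>The permutation is \<open>x \<mapsto> x\<^sup>3\<close>. Since \<open>n = 3 * k + 2\<close>, the exponent \<open>3\<close> is
  invertible modulo \<open>n - 1\<close>, so cubing permutes the residues (\<open>bij_betw_cube\<close>).
  A line that meets the graph in the points over \<open>x, y, z\<close> cannot be vertical, so these abscissae
  are the roots of a polynomial \<open>t\<^sup>3 + a * t - c\<close>. It has no quadratic term, so by Vieta
  \<open>x + y + z = 0\<close>, and conversely every zero-sum triple arises in this way
  (\<open>collinear_cube_triple_iff\<close>). Two zero-sum triples cannot share two elements, so there is no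
  collinear quadruple. It remains to count the zero-sum triples of distinct residues
  (\<open>card_zero_sum_triples\<close>): among the \<open>n\<^sup>2\<close> ordered ones, given by their first two entries,
  \<open>(n - 1) * (n - 2)\<close> have distinct entries, and each set is obtained from 6 of these.\<close>

section \<open>Cubing permutes the residues\<close>

definition cube_Z :: "nat \<Rightarrow> int \<Rightarrow> int"
  where "cube_Z n x = x ^ 3 mod int n"

lemma Zset_eq: "Zset n = {0..<int n}"
  by (auto simp: residue_ring_def)

lemma cong_imp_eq_Zset:
  assumes "[x = y] (mod int n)" "x \<in> Zset n" "y \<in> Zset n"
  shows "x = y"
  using assms by (simp add: Zset_eq cong_def)

text \<open>The exponent \<open>2 * k + 1\<close> inverts cubing: \<open>3 * (2 * k + 1) = 2 * (n - 1) + 1\<close>, so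
  Fermat's theorem applies.\<close>
lemma cube_root_cong:
  fixes x :: int
  assumes "prime n" "n = 3 * k + 2" "0 \<le> x"
  shows "[(x ^ 3) ^ (2 * k + 1) = x] (mod int n)"
proof (cases "int n dvd x")
  case True
  then have "int n dvd (x ^ 3) ^ (2 * k + 1)"
    by (simp add: dvd_mult2 numeral_3_eq_3)
  with True show ?thesis
    by (metis cong_0_iff cong_sym cong_trans)
next
  case False
  have "\<not> n dvd nat x"
    using False assms(3) by (simp add: int_dvd_int_iff[symmetric])
  then have "[nat x ^ (n - 1) = 1] (mod n)"
    using assms(1) fermat_theorem by blast
  then have "[int (nat x ^ (n - 1)) = int 1] (mod int n)"
    by (simp only: cong_int_iff)
  then have "[x ^ (n - 1) = 1] (mod int n)"
    using assms(3) by simp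
  then have "[(x ^ (n - 1)) ^ 2 * x = 1 ^ 2 * x] (mod int n)"
    by (intro cong_mult cong_pow cong_refl)
  moreover have "(x ^ (n - 1)) ^ 2 * x = (x ^ 3) ^ (2 * k + 1)"
  proof -
    have "(x ^ (n - 1)) ^ 2 * x = x ^ ((n - 1) * 2 + 1)"
      by (simp add: power_mult power_add)
    also have "(n - 1) * 2 + 1 = 3 * (2 * k + 1)"
      using assms(2) by simp
    finally show ?thesis
      by (simp only: power_mult)
  qed
  ultimately show ?thesis by simp
qed

lemma bij_betw_cube:
  assumes "prime n" "[n = 2] (mod 3)"
  shows "bij_betw (cube_Z n) (Zset n) (Zset n)"
proof -
  have "n mod 3 = 2"
    using assms(2) by (simp add: cong_def)
  then obtain k where k: "n = 3 * k + 2"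
    by (metis mult_div_mod_eq)
  have "inj_on (cube_Z n) (Zset n)"
  proof (rule inj_onI)
    fix x y assume xy: "x \<in> Zset n" "y \<in> Zset n" "cube_Z n x = cube_Z n y"
    then have "[x ^ 3 = y ^ 3] (mod int n)"
      by (simp add: cube_Z_def cong_def)
    then have "[(x ^ 3) ^ (2 * k + 1) = (y ^ 3) ^ (2 * k + 1)] (mod int n)"
      by (rule cong_pow)
    moreover have "0 \<le> x" "0 \<le> y"
      using xy by (auto simp: Zset_eq)
    ultimately have "[x = y] (mod int n)"
      using cube_root_cong[OF assms(1) k] by (meson cong_sym cong_trans)
    then show "x = y"
      using xy cong_imp_eq_Zset by blast
  qed
  moreover have "cube_Z n ` Zset n \<subseteq> Zset n"
    unfolding Zset_eq using k by (auto simp: cube_Z_def)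
  ultimately show ?thesis
    by (simp add: bij_betw_def Zset_eq endo_inj_surj)
qed

section \<open>Collinearity on the cubic graph\<close>

lemma cube_mem_line_iff:
  assumes "n > 0" "x \<in> Zset n" "c \<in> Zset n"
  shows "(x, cube_Z n x) \<in> line_Z n a b c \<longleftrightarrow> [a * x + b * x ^ 3 = c] (mod int n)"
proof -
  have "(a * x mod int n + b * (x ^ 3 mod int n) mod int n) mod int n
      = (a * x + b * x ^ 3) mod int n"
    by (simp add: mod_simps)
  then show ?thesis
    using assms by (simp add: line_Z_def cube_Z_def residue_ring_def cong_def)
qed

lemma prime_cong_0_mult:
  assumes "prime n" "[u * v = 0] (mod int n)"
  shows "[u = 0] (mod int n) \<or> [v = 0] (mod int n)"
  using assms by (simp add: cong_0_iff prime_dvd_mult_iff)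

text \<open>Subtracting the line equations in pairs and cancelling \<open>x - y\<close> and \<open>x - z\<close> gives
  \<open>a + b * (x\<^sup>2 + x * y + y\<^sup>2) = 0\<close> and its analogue for \<open>z\<close>; the difference of these
  is \<open>b * (y - z) * (x + y + z) = 0\<close>. If \<open>b\<close> vanished, so would \<open>a\<close>.\<close>
lemma collinear_cube_triple_sum:
  assumes n: "prime n" and Z: "x \<in> Zset n" "y \<in> Zset n" "z \<in> Zset n"
    and ne: "x \<noteq> y" "x \<noteq> z" "y \<noteq> z"
    and col: "collinear_Z n ((\<lambda>t. (t, cube_Z n t)) ` {x, y, z})"
  shows "[x + y + z = 0] (mod int n)"
proof -
  have n0: "n > 0"
    using n prime_gt_0_nat by blast
  obtain a b c where ab: "a \<in> Zset n" "b \<in> Zset n" and c: "c \<in> Zset n"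
    and nz: "(a, b) \<noteq> (0, 0)"
    and L: "(\<lambda>t. (t, cube_Z n t)) ` {x, y, z} \<subseteq> line_Z n a b c"
    using col by (auto simp: collinear_Z_def residue_ring_def)
  have line: "[a * x + b * x ^ 3 = c] (mod int n)" "[a * y + b * y ^ 3 = c] (mod int n)"
      "[a * z + b * z ^ 3 = c] (mod int n)"
    using L Z c n0 by (auto simp: cube_mem_line_iff)
  have diff: "\<not> [u - v = 0] (mod int n)" if "u \<in> Zset n" "v \<in> Zset n" "u \<noteq> v" for u v
    using that cong_imp_eq_Zset by (metis cong_diff_iff_cong_0)
  have pair: "[a + b * (x\<^sup>2 + x * t + t\<^sup>2) = 0] (mod int n)"
    if t: "t \<in> Zset n" "x \<noteq> t" "[a * t + b * t ^ 3 = c] (mod int n)" for t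
  proof -
    have "[a * x + b * x ^ 3 - (a * t + b * t ^ 3) = 0] (mod int n)"
      using line(1) t(3) by (meson cong_diff_iff_cong_0 cong_sym cong_trans)
    moreover have "a * x + b * x ^ 3 - (a * t + b * t ^ 3)
        = (x - t) * (a + b * (x\<^sup>2 + x * t + t\<^sup>2))"
      by (simp add: algebra_simps power2_eq_square power3_eq_cube)
    ultimately show ?thesis
      using prime_cong_0_mult[OF n] diff[OF Z(1) t(1,2)] by metis
  qed
  have "[a + b * (x\<^sup>2 + x * y + y\<^sup>2) - (a + b * (x\<^sup>2 + x * z + z\<^sup>2)) = 0 - 0] (mod int n)"
    by (intro cong_diff pair Z ne line)
  moreover have "a + b * (x\<^sup>2 + x * y + y\<^sup>2) - (a + b * (x\<^sup>2 + x * z + z\<^sup>2))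
      = b * ((y - z) * (x + y + z))"
    by (simp add: algebra_simps power2_eq_square)
  ultimately have "[b * ((y - z) * (x + y + z)) = 0] (mod int n)"
    by simp
  moreover have "\<not> [b = 0] (mod int n)"
  proof
    assume "[b = 0] (mod int n)"
    then have b: "b = 0"
      using ab n0 by (intro cong_imp_eq_Zset) (auto simp: Zset_eq)
    then have "[a = 0] (mod int n)"
      using pair[OF Z(2) ne(1) line(2)] by simp
    then have "a = 0"
      using ab n0 by (intro cong_imp_eq_Zset) (auto simp: Zset_eq)
    with b nz show False by simp
  qed
  ultimately show ?thesis
    using prime_cong_0_mult[OF n] diff[OF Z(2,3) ne(3)] by blast
qed

lemma collinear_cube_triple_iff:
  assumes n: "prime n" and Z: "x \<in> Zset n" "y \<in> Zset n" "z \<in> Zset n"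
    and ne: "x \<noteq> y" "x \<noteq> z" "y \<noteq> z"
  shows "collinear_Z n ((\<lambda>t. (t, cube_Z n t)) ` {x, y, z}) \<longleftrightarrow> [x + y + z = 0] (mod int n)"
proof
  assume s: "[x + y + z = 0] (mod int n)"
  \<comment> \<open>Vieta's formulas: \<open>x, y, z\<close> are the roots of \<open>t\<^sup>3 + a * t - c\<close>.\<close>
  let ?a = "(x * y + y * z + z * x) mod int n" and ?c = "x * y * z mod int n"
  have n1: "n > 1"
    using n prime_gt_1_nat by blast
  have c: "?c \<in> Zset n" and a: "?a \<in> Zset n" and one: "1 \<in> Zset n"
    using n1 by (auto simp: Zset_eq)
  have "(t, cube_Z n t) \<in> line_Z n ?a 1 ?c" if t: "t \<in> {x, y, z}" for t
  proof -
    have "(x * y + y * z + z * x) * t + 1 * t ^ 3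
        = (x + y + z) * t\<^sup>2 + x * y * z + (t - x) * (t - y) * (t - z)"
      by (simp add: algebra_simps power2_eq_square power3_eq_cube)
    also have "(t - x) * (t - y) * (t - z) = 0"
      using t by auto
    finally have "(x * y + y * z + z * x) * t + 1 * t ^ 3 = (x + y + z) * t\<^sup>2 + x * y * z"
      by simp
    moreover have "[(x + y + z) * t\<^sup>2 + x * y * z = 0 * t\<^sup>2 + x * y * z] (mod int n)"
      using s by (intro cong_add cong_mult cong_refl)
    moreover have "[?a * t + 1 * t ^ 3 = (x * y + y * z + z * x) * t + 1 * t ^ 3] (mod int n)"
      by (intro cong_add cong_mult cong_refl) simp
    ultimately have "[?a * t + 1 * t ^ 3 = ?c] (mod int n)"
      by (simp add: cong_def)
    then show ?thesis
      using cube_mem_line_iff[OF _ _ c] t Z n1 by auto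
  qed
  then have "(\<lambda>t. (t, cube_Z n t)) ` {x, y, z} \<subseteq> line_Z n ?a 1 ?c"
    by (rule image_subsetI)
  moreover have "(?a, 1) \<noteq> (\<zero>\<^bsub>Zmod n\<^esub>, \<zero>\<^bsub>Zmod n\<^esub>)"
    by (simp add: residue_ring_def)
  ultimately show "collinear_Z n ((\<lambda>t. (t, cube_Z n t)) ` {x, y, z})"
    unfolding collinear_Z_def using a one c by blast
qed (rule collinear_cube_triple_sum[OF assms])

lemma collinear_Z_subset: "collinear_Z n X \<Longrightarrow> Y \<subseteq> X \<Longrightarrow> collinear_Z n Y"
  unfolding collinear_Z_def by blast

lemma subset_graph_ZE:
  assumes "X \<subseteq> graph_Z n \<sigma>"
  obtains A where "A \<subseteq> Zset n" "X = (\<lambda>t. (t, \<sigma> t)) ` A" "card A = card X"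
proof -
  have "X \<subseteq> (\<lambda>t. (t, \<sigma> t)) ` Zset n"
    using assms by (auto simp: graph_Z_def)
  then obtain A where A: "A \<subseteq> Zset n" "X = (\<lambda>t. (t, \<sigma> t)) ` A"
    by (auto simp: subset_image_iff)
  moreover have "inj_on (\<lambda>t. (t, \<sigma> t)) A"
    by (auto intro: inj_onI)
  ultimately show ?thesis
    using that card_image by metis
qed

lemma no_collinear_quadruple_cube:
  assumes n: "prime n"
  shows "collinear_quadruples n (graph_Z n (cube_Z n)) = {}"
proof -
  have False if X: "X \<subseteq> graph_Z n (cube_Z n)" "card X = 4" "collinear_Z n X" for X
  proof -
    obtain A where A: "A \<subseteq> Zset n" "X = (\<lambda>t. (t, cube_Z n t)) ` A" "card A = 4"
      using subset_graph_ZE[OF X(1)] X(2) by metis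
    then obtain x B where xB: "A = insert x B" "x \<notin> B" "card B = 3"
      using card_Suc_eq[of A 3] by auto
    then obtain y z w where B: "B = {y, z, w}" "y \<noteq> z" "y \<noteq> w" "z \<noteq> w"
      by (auto simp: card_3_iff)
    have Z: "x \<in> Zset n" "y \<in> Zset n" "z \<in> Zset n" "w \<in> Zset n"
      using A(1) xB B by auto
    have ne: "x \<noteq> y" "x \<noteq> z" "x \<noteq> w"
      using xB B by auto
    have "collinear_Z n ((\<lambda>t. (t, cube_Z n t)) ` {x, y, z})"
      "collinear_Z n ((\<lambda>t. (t, cube_Z n t)) ` {x, y, w})"
      using A xB B by (auto intro!: collinear_Z_subset[OF X(3)])
    then have "[x + y + z = 0] (mod int n)" "[x + y + w = 0] (mod int n)"
      using collinear_cube_triple_sum[OF n] Z ne B by blast+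
    then have "[x + y + z = x + y + w] (mod int n)"
      by (meson cong_sym cong_trans)
    then have "z = w"
      using Z cong_imp_eq_Zset cong_add_lcancel by metis
    with B show False by simp
  qed
  then show ?thesis
    unfolding collinear_quadruples_def by blast
qed

section \<open>Counting zero-sum triples\<close>

definition zero_sum_triples :: "nat \<Rightarrow> int set set"
  where "zero_sum_triples n = {A. A \<subseteq> Zset n \<and> card A = 3 \<and> [\<Sum>A = 0] (mod int n)}"

lemma card_collinear_triples_cube:
  assumes n: "prime n"
  shows "card (collinear_triples n (graph_Z n (cube_Z n))) = card (zero_sum_triples n)"
proof -
  let ?pt = "\<lambda>t. (t, cube_Z n t)"
  have inj: "inj ?pt"
    by (auto intro: injI)
  have iff: "collinear_Z n (?pt ` A) \<longleftrightarrow> [\<Sum>A = 0] (mod int n)"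
    if A: "A \<subseteq> Zset n" "card A = 3" for A
  proof -
    obtain x y z where xyz: "A = {x, y, z}" "x \<noteq> y" "x \<noteq> z" "y \<noteq> z"
      using A(2) by (auto simp: card_3_iff)
    then have "\<Sum>A = x + y + z" by simp
    moreover have "collinear_Z n (?pt ` A) \<longleftrightarrow> [x + y + z = 0] (mod int n)"
      unfolding xyz(1) using A(1) xyz by (intro collinear_cube_triple_iff[OF n]) auto
    ultimately show ?thesis by simp
  qed
  have "collinear_triples n (graph_Z n (cube_Z n)) = image ?pt ` zero_sum_triples n"
  proof (intro equalityI subsetI)
    fix X assume "X \<in> collinear_triples n (graph_Z n (cube_Z n))"
    then have X: "X \<subseteq> graph_Z n (cube_Z n)" "card X = 3" "collinear_Z n X"
      by (auto simp: collinear_triples_def)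
    obtain A where A: "A \<subseteq> Zset n" "X = ?pt ` A" "card A = 3"
      using subset_graph_ZE[OF X(1)] X(2) by metis
    then have "A \<in> zero_sum_triples n"
      using iff[OF A(1,3)] X(3) by (simp add: zero_sum_triples_def)
    with A(2) show "X \<in> image ?pt ` zero_sum_triples n" by blast
  next
    fix X assume "X \<in> image ?pt ` zero_sum_triples n"
    then obtain A where A: "A \<subseteq> Zset n" "card A = 3" "[\<Sum>A = 0] (mod int n)" "X = ?pt ` A"
      by (auto simp: zero_sum_triples_def)
    moreover have "card X = 3"
      using A inj by (simp add: card_image inj_on_subset)
    ultimately show "X \<in> collinear_triples n (graph_Z n (cube_Z n))"
      using iff by (auto simp: collinear_triples_def graph_Z_def)
  qed
  moreover have "inj_on (image ?pt) (zero_sum_triples n)"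
    using inj by (auto intro!: inj_onI simp: inj_image_eq_iff)
  ultimately show ?thesis
    by (simp add: card_image)
qed

text \<open>A zero-sum triple with an enumeration of its elements is determined by the first two;
  the third is then \<open>- x - y\<close>, and the last two conditions say that it differs from
  \<open>x\<close> and \<open>y\<close>.\<close>
definition zero_sum_pairs :: "nat \<Rightarrow> (int \<times> int) set"
  where "zero_sum_pairs n = {(x, y). x \<in> Zset n \<and> y \<in> Zset n \<and> x \<noteq> y \<and>
    \<not> [2 * x + y = 0] (mod int n) \<and> \<not> [x + 2 * y = 0] (mod int n)}"

text \<open>For \<open>x = 0\<close> only \<open>y = 0\<close> is excluded. For \<open>x \<noteq> 0\<close> the excluded values
  are \<open>x\<close>, \<open>- 2 * x\<close> and \<open>- x / 2\<close>, which are distinct because any coincidence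
  gives \<open>3 * x = 0\<close>. The total is therefore \<open>(n - 1) + (n - 1) * (n - 3)\<close>.\<close>
lemma card_zero_sum_pairs:
  assumes n: "n > 2" and odd: "odd n" and cop: "coprime n 3"
  shows "card (zero_sum_pairs n) = (n - 1) * (n - 2)"
proof -
  obtain h where h: "n = 2 * h + 1"
    using odd by (elim oddE)
  \<comment> \<open>\<open>h\<close> represents \<open>- 1 / 2\<close> modulo \<open>n\<close>.\<close>
  have half: "[2 * (int h * x) = - x] (mod int n)" for x
  proof -
    have "2 * (int h * x) - (- x) = int n * x"
      by (simp add: h algebra_simps)
    then show ?thesis
      by (simp add: cong_iff_dvd_diff)
  qed
  have cop2: "coprime 2 (int n)"
    using odd by simp
  define E where "E x = {x, (- 2 * x) mod int n, (int h * x) mod int n}" for x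
  have mem: "x \<in> Zset n \<Longrightarrow> x mod int n = x" and mod_mem: "x mod int n \<in> Zset n" for x
    using n by (auto simp: Zset_eq)
  have excl1: "[2 * x + y = 0] (mod int n) \<longleftrightarrow> y = (- 2 * x) mod int n" if "y \<in> Zset n" for x y
  proof -
    have "[2 * x + y = 0] (mod int n) \<longleftrightarrow> [y = - 2 * x] (mod int n)"
      by (simp add: cong_iff_dvd_diff algebra_simps)
    then show ?thesis
      using mem[OF that] by (simp add: cong_def)
  qed
  have excl2: "[x + 2 * y = 0] (mod int n) \<longleftrightarrow> y = (int h * x) mod int n" if "y \<in> Zset n" for x y
  proof -
    have "[x + 2 * y = 0] (mod int n) \<longleftrightarrow> [2 * y = - x] (mod int n)"
      by (simp add: cong_iff_dvd_diff algebra_simps)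
    also have "\<dots> \<longleftrightarrow> [2 * y = 2 * (int h * x)] (mod int n)"
      using half[of x] by (meson cong_sym cong_trans)
    also have "\<dots> \<longleftrightarrow> [y = int h * x] (mod int n)"
      using cop2 by (rule cong_mult_lcancel)
    finally show ?thesis
      using mem[OF that] by (simp add: cong_def)
  qed
  have Sig: "zero_sum_pairs n = (SIGMA x:Zset n. Zset n - E x)"
    by (auto simp: zero_sum_pairs_def E_def excl1 excl2)
  have E0: "card (E 0) = 1"
    by (simp add: E_def)
  have E3: "card (E x) = 3" if x: "x \<in> Zset n - {0}" for x
  proof -
    have triple: "\<not> int n dvd 3 * x"
    proof
      assume "int n dvd 3 * x"
      moreover have "coprime (int n) 3"
        using cop coprime_int_iff[of n 3] by simp
      ultimately have "int n dvd x"
        by (simp add: coprime_dvd_mult_right_iff)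
      with x show False
        using zdvd_imp_le[of "int n" x] by (auto simp: Zset_eq)
    qed
    have "\<not> [x = - 2 * x] (mod int n)"
      using triple by (simp add: cong_iff_dvd_diff)
    then have 1: "x \<noteq> (- 2 * x) mod int n"
      by (metis cong_mod_right cong_refl)
    have 2: "x \<noteq> (int h * x) mod int n"
    proof
      assume "x = (int h * x) mod int n"
      then have "[x = int h * x] (mod int n)"
        by (metis cong_mod_left cong_refl)
      then have "[2 * x = 2 * (int h * x)] (mod int n)"
        by (rule cong_scalar_left)
      then have "[2 * x = - x] (mod int n)"
        using half cong_trans by blast
      with triple show False
        by (simp add: cong_iff_dvd_diff)
    qed
    have 3: "(- 2 * x) mod int n \<noteq> (int h * x) mod int n"
    proof
      assume "(- 2 * x) mod int n = (int h * x) mod int n"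
      then have "[- 2 * x = int h * x] (mod int n)"
        by (simp only: cong_def)
      then have "[2 * (- 2 * x) = 2 * (int h * x)] (mod int n)"
        by (rule cong_scalar_left)
      then have "[2 * (- 2 * x) = - x] (mod int n)"
        using half cong_trans by blast
      then have "int n dvd - (3 * x)"
        by (simp add: cong_iff_dvd_diff)
      with triple show False by simp
    qed
    show ?thesis
      using 1 2 3 unfolding E_def card_3_iff by blast
  qed
  have sub: "E x \<subseteq> Zset n" if "x \<in> Zset n" for x
    using that mod_mem by (auto simp: E_def)
  have fin: "finite (Zset n)" and cZ: "card (Zset n) = n" and zero: "0 \<in> Zset n"
    using n by (auto simp: Zset_eq)
  have "card (zero_sum_pairs n) = (\<Sum>x\<in>Zset n. card (Zset n - E x))"
    unfolding Sig using fin by simp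
  also have "\<dots> = (\<Sum>x\<in>Zset n. n - card (E x))"
    using sub fin cZ by (intro sum.cong refl) (metis card_Diff_subset finite_subset)
  also have "\<dots> = (n - card (E 0)) + (\<Sum>x\<in>Zset n - {0}. n - card (E x))"
    using fin zero by (rule sum.remove)
  also have "\<dots> = (n - 1) + (\<Sum>x\<in>Zset n - {0}. n - 3)"
    using E0 E3 by (metis (no_types, lifting) sum.cong)
  also have "\<dots> = (n - 1) + (n - 1) * (n - 3)"
    using fin zero cZ by simp
  also have "\<dots> = (n - 1) * (1 + (n - 3))"
    by (simp add: distrib_left)
  also have "1 + (n - 3) = n - 2"
    using n by simp
  finally show ?thesis .
qed

lemma zero_sum_triple_eq:
  assumes A: "A \<in> zero_sum_triples n" and xy: "x \<in> A" "y \<in> A" "x \<noteq> y"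
  shows "A = {x, y, (- x - y) mod int n}"
proof -
  have cA: "card A = 3" and AZ: "A \<subseteq> Zset n" and s: "[\<Sum>A = 0] (mod int n)"
    using A by (auto simp: zero_sum_triples_def)
  have "card (A - {x, y}) = 1"
    using cA xy by (simp add: card_Diff_subset)
  then obtain z where z: "A - {x, y} = {z}"
    by (auto simp: card_1_singleton_iff)
  then have Axyz: "A = {x, y, z}" and zn: "z \<noteq> x" "z \<noteq> y"
    using xy by auto
  then have "[x + y + z = 0] (mod int n)"
    using s xy by (simp add: add.assoc)
  then have "[z = - x - y] (mod int n)"
    by (simp add: cong_iff_dvd_diff algebra_simps)
  moreover have "z mod int n = z"
    using AZ Axyz by (auto simp: Zset_eq)
  ultimately show ?thesis
    using Axyz by (simp add: cong_def)
qed

lemma zero_sum_pairs_eq_UN: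
  assumes n: "n > 0"
  shows "zero_sum_pairs n = (\<Union>A\<in>zero_sum_triples n. SIGMA x:A. A - {x})"
proof (intro equalityI subsetI)
  fix p assume "p \<in> zero_sum_pairs n"
  then obtain x y where p: "p = (x, y)" and Z: "x \<in> Zset n" "y \<in> Zset n" and ne: "x \<noteq> y"
    and ns: "\<not> [2 * x + y = 0] (mod int n)" "\<not> [x + 2 * y = 0] (mod int n)"
    by (auto simp: zero_sum_pairs_def)
  define z where "z = (- x - y) mod int n"
  have zZ: "z \<in> Zset n"
    using n by (simp add: z_def Zset_eq)
  have "[z = - x - y] (mod int n)"
    by (simp add: z_def)
  then have s: "[x + (y + z) = 0] (mod int n)"
    by (simp add: cong_iff_dvd_diff algebra_simps)
  then have "z \<noteq> x" "z \<noteq> y"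
    using ns by (auto simp: algebra_simps)
  then have "{x, y, z} \<in> zero_sum_triples n"
    using Z zZ ne s by (simp add: zero_sum_triples_def)
  then show "p \<in> (\<Union>A\<in>zero_sum_triples n. SIGMA x:A. A - {x})"
    using p ne by blast
next
  fix p assume "p \<in> (\<Union>A\<in>zero_sum_triples n. SIGMA x:A. A - {x})"
  then obtain A x y where A: "A \<in> zero_sum_triples n" and p: "p = (x, y)"
    and xy: "x \<in> A" "y \<in> A" "x \<noteq> y"
    by blast
  have Z: "x \<in> Zset n" "y \<in> Zset n" and cA: "card A = 3"
    using A xy by (auto simp: zero_sum_triples_def)
  define z where "z = (- x - y) mod int n"
  have Axyz: "A = {x, y, z}"
    using zero_sum_triple_eq[OF A xy] by (simp add: z_def)
  have "z \<noteq> x" "z \<noteq> y"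
    using cA unfolding Axyz by (auto simp: card_insert_if split: if_splits)
  moreover have "z = u" if "[u = - x - y] (mod int n)" "u \<in> Zset n" for u
    using that by (simp add: z_def cong_def Zset_eq)
  ultimately have "\<not> [x = - x - y] (mod int n)" "\<not> [y = - x - y] (mod int n)"
    using Z by auto
  then show "p \<in> zero_sum_pairs n"
    using p Z xy by (simp add: zero_sum_pairs_def cong_iff_dvd_diff algebra_simps)
qed

lemma card_zero_sum_triples:
  assumes "n > 2" "odd n" "coprime n 3"
  shows "6 * card (zero_sum_triples n) = (n - 1) * (n - 2)"
proof -
  have fin: "finite A" and c3: "card A = 3" if "A \<in> zero_sum_triples n" for A
    using that by (auto simp: zero_sum_triples_def intro: card_ge_0_finite)
  have finT: "finite (zero_sum_triples n)"
    by (rule finite_subset[of _ "Pow (Zset n)"]) (auto simp: zero_sum_triples_def Zset_eq)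
  have six: "card (SIGMA x:A. A - {x}) = 6" if "A \<in> zero_sum_triples n" for A
    using fin[OF that] c3[OF that] by simp
  have disj: "(SIGMA x:A. A - {x}) \<inter> (SIGMA x:B. B - {x}) = {}"
    if "A \<in> zero_sum_triples n" "B \<in> zero_sum_triples n" "A \<noteq> B" for A B
  proof -
    have "A = B" if "x \<in> A" "x \<in> B" "y \<in> A" "y \<in> B" "x \<noteq> y" for x y
      using zero_sum_triple_eq[OF \<open>A \<in> zero_sum_triples n\<close> that(1,3,5)]
        zero_sum_triple_eq[OF \<open>B \<in> zero_sum_triples n\<close> that(2,4,5)] by (rule trans[OF _ sym])
    with \<open>A \<noteq> B\<close> show ?thesis by blast
  qed
  have finF: "finite (SIGMA x:A. A - {x})" if "A \<in> zero_sum_triples n" for A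
    using fin[OF that] by simp
  have "card (zero_sum_pairs n) = card (\<Union>A\<in>zero_sum_triples n. SIGMA x:A. A - {x})"
    using assms(1) by (subst zero_sum_pairs_eq_UN) simp_all
  also have "\<dots> = (\<Sum>A\<in>zero_sum_triples n. card (SIGMA x:A. A - {x}))"
    by (rule card_UN_disjoint[OF finT]) (use finF disj in blast)+
  also have "\<dots> = 6 * card (zero_sum_triples n)"
    using six by simp
  finally show ?thesis
    using card_zero_sum_pairs[OF assms] by simp
qed

theorem mainTheorem4:
  fixes n :: nat
  assumes "prime n" and "n > 2" and "[n = 2] (mod 3)"
  shows "\<exists>\<sigma>. perm_Z n \<sigma> \<and>
    real (card (collinear_triples n (graph_Z n \<sigma>))) = (real n - 1) * (real n - 2) / 6 \<and>
    collinear_quadruples n (graph_Z n \<sigma>) = {}"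
proof (intro exI conjI)
  show "perm_Z n (cube_Z n)"
    unfolding perm_Z_def by (rule bij_betw_cube[OF assms(1,3)])
  have "n \<noteq> 3"
    using assms(3) by (auto simp: cong_def)
  then have "odd n" "coprime n 3"
    using assms(1,2) by (auto simp: prime_odd_nat intro!: primes_coprime)
  then have "real (6 * card (zero_sum_triples n)) = real ((n - 1) * (n - 2))"
    using card_zero_sum_triples[OF assms(2)] by metis
  then show "real (card (collinear_triples n (graph_Z n (cube_Z n))))
      = (real n - 1) * (real n - 2) / 6"
    using assms(2) by (simp add: card_collinear_triples_cube[OF assms(1)])
  show "collinear_quadruples n (graph_Z n (cube_Z n)) = {}"
    by (rule no_collinear_quadruple_cube[OF assms(1)])
qed

end
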